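(* Let $(\{\omega_{n+1/2}\}_{n\ge 0},\{\alpha_n\}_{n\ge 0})$ be a Jacobi sequence and let $\Gamma_{\omega,\alpha}=(\Gamma(\mathbb{C}),A,B,C)$ be the associated interacting Fock space, with $X=A+B+C$. Suppose that $\Gamma_{\omega,\alpha}$ satisfies (RAC1), that is, $$\lim_{n\to\infty}\frac{(AC-CA)\Phi_n}{\omega_{n+1/2}+\omega_{n-1/2}}=0\quad\text{and}\quad \lim_{n\to\infty}\frac{(AB-BA)\Phi_n}{\omega_{n+1/2}+\omega_{n-1/2}}=0 .$$ Then the classical limit distribution of $\Gamma_{\omega,\alpha}$ exists and is the arcsine law $\dfrac{dx}{\pi\sqrt{2-x^2}}$ on $(-\sqrt2,\sqrt2)$; that is, for every $m\in\mathbb{N}$, $$\lim_{n\to\infty}\left\langle\left(\frac{X-\alpha_n}{\sqrt{\omega_{n+1/2}+\omega_{n-1/2}}}\right)^m\Phi_n,\Phi_n\right\rangle=\int_{-\sqrt2}^{\sqrt2}x^m\,\frac{dx}{\pi\sqrt{2-x^2}} .$$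
   Context: A Jacobi sequence is a pair $(\{\omega_{n+1/2}\}_{n\ge0},\{\alpha_n\}_{n\ge0})$ where $\omega_{1/2},\omega_{3/2},\omega_{5/2},\dots$ are positive real numbers (labeled by half-integers) and $\alpha_0,\alpha_1,\dots$ are real numbers. The associated interacting Fock space $\Gamma_{\omega,\alpha}=(\Gamma(\mathbb{C}),A,B,C)$ consists of the pre-Hilbert space $\Gamma(\mathbb{C})=\bigoplus_{n=0}^\infty\mathbb{C}\Phi_n$ (algebraic direct sum) with $\langle\Phi_n,\Phi_m\rangle=\delta_{n,m}$, and the linear operators on it given by $A\Phi_0=0$, $A\Phi_n=\sqrt{\omega_{n-1/2}}\,\Phi_{n-1}$ for $n\ge1$; $B\Phi_n=\alpha_n\Phi_n$; $C\Phi_n=\sqrt{\omega_{n+1/2}}\,\Phi_{n+1}$. Limits of vectors are taken in the norm of the inner product. A scalar such as $\alpha_n$ in an operator expression denotes that multiple of the identity. Classical limit distribution: for each $n\ge 1$ let $\mu_n$ be a probability distribution on $\mathbb{R}$ whose $m$-th moment equals $\left\langle\left(\frac{X-\alpha_n}{\sqrt{\omega_{n+1/2}+\omega_{n-1/2}}}\right)^m\Phi_n,\Phi_n\right\rangle$ for all $m\in\mathbb{N}$. A probability distribution $\mu$ on $\mathbb{R}$ is called a classical limit distribution of $\Gamma_{\omega,\alpha}$ if $\mu_n$ converges to $\mu$ in moments, i.e. for each $m$ the $m$-th moment of $\mu_n$ converges to the $m$-th moment of $\mu$. *)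

theory Defs
  imports "HOL-Probability.Probability" "HOL-Library.Poly_Mapping"
begin

(* The algebraic direct sum of the lines spanned by Phi_0, Phi_1, ...:
   finitely supported coefficient families. *)
type_synonym fock = "nat \<Rightarrow>\<^sub>0 complex"

definition Phi :: "nat \<Rightarrow> fock" where
  "Phi n = Poly_Mapping.single n 1"

definition fscale :: "complex \<Rightarrow> fock \<Rightarrow> fock" where
  "fscale c v = Poly_Mapping.map ((*) c) v"

(* Linear in the first argument, conjugate-linear in the second. *)
definition finner :: "fock \<Rightarrow> fock \<Rightarrow> complex" where
  "finner v w = (\<Sum>n \<in> Poly_Mapping.keys v \<union> Poly_Mapping.keys w.
     Poly_Mapping.lookup v n * cnj (Poly_Mapping.lookup w n))"

definition fnorm :: "fock \<Rightarrow> real" where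
  "fnorm v = sqrt (Re (finner v v))"

definition ftendsto :: "(nat \<Rightarrow> fock) \<Rightarrow> fock \<Rightarrow> bool" where
  "ftendsto v l \<longleftrightarrow> (\<lambda>n. fnorm (v n - l)) \<longlonglongrightarrow> 0"

(* The linear operator with prescribed values on the basis vectors. *)
definition lin_ext :: "(nat \<Rightarrow> fock) \<Rightarrow> fock \<Rightarrow> fock" where
  "lin_ext b v = (\<Sum>n \<in> Poly_Mapping.keys v. fscale (Poly_Mapping.lookup v n) (b n))"

(* Half-integer labels are shifted down: "w n" stands for omega_{n+1/2}, so that
   omega_{n-1/2} is "w (n - 1)" for n \<ge> 1. *)
definition jacobi_sequence :: "(nat \<Rightarrow> real) \<Rightarrow> (nat \<Rightarrow> real) \<Rightarrow> bool" where
  "jacobi_sequence w a \<longleftrightarrow> (\<forall>n. w n > 0)"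

definition opA :: "(nat \<Rightarrow> real) \<Rightarrow> fock \<Rightarrow> fock" where
  "opA w = lin_ext (\<lambda>n. if n = 0 then 0 else fscale (complex_of_real (sqrt (w (n - 1)))) (Phi (n - 1)))"

definition opB :: "(nat \<Rightarrow> real) \<Rightarrow> fock \<Rightarrow> fock" where
  "opB a = lin_ext (\<lambda>n. fscale (complex_of_real (a n)) (Phi n))"

definition opC :: "(nat \<Rightarrow> real) \<Rightarrow> fock \<Rightarrow> fock" where
  "opC w = lin_ext (\<lambda>n. fscale (complex_of_real (sqrt (w n))) (Phi (n + 1)))"

definition opX :: "(nat \<Rightarrow> real) \<Rightarrow> (nat \<Rightarrow> real) \<Rightarrow> fock \<Rightarrow> fock" where
  "opX w a v = opA w v + opB a v + opC w v"

(* omega_{n+1/2} + omega_{n-1/2}; it is only meaningful for n \<ge> 1, and its junk value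
   at n = 0 enters below only as the initial term of a sequence whose limit is taken. *)
definition wsum :: "(nat \<Rightarrow> real) \<Rightarrow> nat \<Rightarrow> real" where
  "wsum w n = w n + w (n - 1)"

definition RAC1 :: "(nat \<Rightarrow> real) \<Rightarrow> (nat \<Rightarrow> real) \<Rightarrow> bool" where
  "RAC1 w a \<longleftrightarrow>
     ftendsto (\<lambda>n. fscale (complex_of_real (1 / wsum w n))
       (opA w (opC w (Phi n)) - opC w (opA w (Phi n)))) 0 \<and>
     ftendsto (\<lambda>n. fscale (complex_of_real (1 / wsum w n))
       (opA w (opB a (Phi n)) - opB a (opA w (Phi n)))) 0"

definition normalized_X :: "(nat \<Rightarrow> real) \<Rightarrow> (nat \<Rightarrow> real) \<Rightarrow> nat \<Rightarrow> fock \<Rightarrow> fock" where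
  "normalized_X w a n v =
     fscale (complex_of_real (1 / sqrt (wsum w n))) (opX w a v - fscale (complex_of_real (a n)) v)"

definition fock_moment :: "(nat \<Rightarrow> real) \<Rightarrow> (nat \<Rightarrow> real) \<Rightarrow> nat \<Rightarrow> nat \<Rightarrow> complex" where
  "fock_moment w a n m = finner ((normalized_X w a n ^^ m) (Phi n)) (Phi n)"

definition finite_moments :: "real measure \<Rightarrow> bool" where
  "finite_moments M \<longleftrightarrow> (\<forall>m::nat. integrable M (\<lambda>x. x ^ m))"

definition moment :: "real measure \<Rightarrow> nat \<Rightarrow> real" where
  "moment M m = integral\<^sup>L M (\<lambda>x. x ^ m)"

definition converges_in_moments :: "(nat \<Rightarrow> real measure) \<Rightarrow> real measure \<Rightarrow> bool" where
  "converges_in_moments N M \<longleftrightarrow> (\<forall>m. (\<lambda>n. moment (N n) m) \<longlonglongrightarrow> moment M m)"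

(* N n is a probability distribution on the reals with the moments of the normalized X
   in the state Phi n.  Such measures exist but need not be unique. *)
definition represents_moments ::
  "(nat \<Rightarrow> real) \<Rightarrow> (nat \<Rightarrow> real) \<Rightarrow> (nat \<Rightarrow> real measure) \<Rightarrow> bool" where
  "represents_moments w a N \<longleftrightarrow>
     (\<forall>n\<ge>1. real_distribution (N n) \<and> finite_moments (N n) \<and>
        (\<forall>m. complex_of_real (moment (N n) m) = fock_moment w a n m))"

(* The choice of the representing measures is immaterial: their moments are prescribed. *)
definition classical_limit_distribution ::
  "(nat \<Rightarrow> real) \<Rightarrow> (nat \<Rightarrow> real) \<Rightarrow> real measure \<Rightarrow> bool" where
  "classical_limit_distribution w a M \<longleftrightarrow>
     real_distribution M \<and> finite_moments M \<and>
     (\<forall>N. represents_moments w a N \<longrightarrow> converges_in_moments N M)"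

definition arcsine_law :: "real measure" where
  "arcsine_law = density lborel
     (\<lambda>x. ennreal (indicator {- sqrt 2<..<sqrt 2} x * (1 / (pi * sqrt (2 - x\<^sup>2)))))"

lemma lookup_fscale [simp]:
  "Poly_Mapping.lookup (fscale c v) n = c * Poly_Mapping.lookup v n"
  by (simp add: fscale_def Poly_Mapping.map.rep_eq when_def)

interpretation fock: vector_space fscale
  by unfold_locales (auto intro!: poly_mapping_eqI simp: lookup_add algebra_simps)

lemma lin_ext_superset:
  assumes "finite S" "Poly_Mapping.keys v \<subseteq> S"
  shows "lin_ext b v = (\<Sum>n\<in>S. fscale (Poly_Mapping.lookup v n) (b n))"
  unfolding lin_ext_def using assms
  by (intro sum.mono_neutral_left) (auto simp: in_keys_iff)

lemma linear_lin_ext: "Vector_Spaces.linear fscale fscale (lin_ext b)"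
proof unfold_locales
  fix v u :: fock and c :: complex
  let ?S = "Poly_Mapping.keys v \<union> Poly_Mapping.keys u"
  have "Poly_Mapping.keys (v + u) \<subseteq> ?S" by (rule Poly_Mapping.keys_add)
  then show "lin_ext b (v + u) = lin_ext b v + lin_ext b u"
    by (simp add: lin_ext_superset[of ?S] lookup_add fock.scale_left_distrib sum.distrib)
  have "Poly_Mapping.keys (fscale c v) \<subseteq> Poly_Mapping.keys v"
    by (auto simp: in_keys_iff)
  then show "lin_ext b (fscale c v) = fscale c (lin_ext b v)"
    by (simp add: lin_ext_superset[of "Poly_Mapping.keys v"] fock.scale_sum_right)
qed

lemma lin_ext_Phi [simp]: "lin_ext b (Phi n) = b n"
  by (simp add: lin_ext_def Phi_def)

lemma finner_Phi: "finner (Phi n) (Phi m) = (if n = m then 1 else 0)"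
  by (auto simp: finner_def Phi_def lookup_single when_def)

lemma opA_Phi_0: "opA w (Phi 0) = 0"
  by (simp add: opA_def)

lemma opA_Phi: "n \<ge> 1 \<Longrightarrow> opA w (Phi n) = fscale (complex_of_real (sqrt (w (n - 1)))) (Phi (n - 1))"
  by (simp add: opA_def)

lemma opB_Phi: "opB a (Phi n) = fscale (complex_of_real (a n)) (Phi n)"
  by (simp add: opB_def)

lemma opC_Phi: "opC w (Phi n) = fscale (complex_of_real (sqrt (w n))) (Phi (n + 1))"
  by (simp add: opC_def)

end

theory Submission
  imports Defs
begin

text \<open>
  (RAC1) says that \<open>w (n + 1) / w n \<longlonglongrightarrow> 1\<close> and \<open>(a (n + 1) - a n) / sqrt (w n) \<longlonglongrightarrow> 0\<close>.
  Near the site \<open>n\<close> the normalized \<open>X\<close> therefore approaches \<open>(S + S\<^sup>*) / sqrt 2\<close>, where \<open>S\<close> is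
  the bilateral shift on \<open>\<int>\<close>: the coefficient of \<open>Phi (n + k)\<close> in its \<open>m\<close>-th power applied
  to \<open>Phi n\<close> has a limit \<open>L m k\<close> with \<open>L (m + 1) k = (L m (k + 1) + L m (k - 1)) / sqrt 2\<close>.
  Diagonalizing the shift by Fourier series gives
  \<open>L m k = 1 / pi * (integral of (sqrt 2 * cos u) ^ m * cos (k * u) over 0 \<le> u \<le> pi)\<close>, and for
  \<open>k = 0\<close> the substitution \<open>x = sqrt 2 * cos u\<close> turns this into the arcsine moment.
\<close>

section \<open>Coefficients of vectors, operators and norms\<close>

lemma lookup_lin_ext:
  "Poly_Mapping.lookup (lin_ext b v) j =
    (\<Sum>n\<in>Poly_Mapping.keys v. Poly_Mapping.lookup v n * Poly_Mapping.lookup (b n) j)"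
  by (simp add: lin_ext_def lookup_sum)

text \<open>Row \<open>j\<close> of the matrix has a single possible entry \<open>c\<close>, in
  column \<open>i\<close>, so the sum over the support collapses; if \<open>i\<close> lies outside
  the support, both sides vanish. All three operators have such rows.\<close>

lemma lookup_lin_ext_shift:
  assumes "\<And>n. Poly_Mapping.lookup (b n) j = (if n = i then c else 0)"
  shows "Poly_Mapping.lookup (lin_ext b v) j = c * Poly_Mapping.lookup v i"
  by (auto simp: lookup_lin_ext assms if_distrib sum.delta in_keys_iff cong: if_cong)

lemma lookup_Phi: "Poly_Mapping.lookup (Phi n) j = (if n = j then 1 else 0)"
  by (simp add: Phi_def lookup_single when_def)

lemma lookup_opA:
  "Poly_Mapping.lookup (opA w v) j = complex_of_real (sqrt (w j)) * Poly_Mapping.lookup v (Suc j)"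
  unfolding opA_def by (rule lookup_lin_ext_shift) (auto simp: lookup_Phi)

lemma lookup_opB:
  "Poly_Mapping.lookup (opB a v) j = complex_of_real (a j) * Poly_Mapping.lookup v j"
  unfolding opB_def by (rule lookup_lin_ext_shift) (auto simp: lookup_Phi)

lemma lookup_opC_Suc:
  "Poly_Mapping.lookup (opC w v) (Suc j) = complex_of_real (sqrt (w j)) * Poly_Mapping.lookup v j"
  unfolding opC_def by (rule lookup_lin_ext_shift) (auto simp: lookup_Phi)

text \<open>This is a generic row of the tridiagonal matrix. Row 0 lacks the term from
  \<open>opC\<close>, but for a fixed shift \<open>k\<close> the site \<open>n + k\<close> is
  eventually positive, so only successor rows matter in the limit.\<close>

lemma lookup_normalized_X_Suc:
  "Poly_Mapping.lookup (normalized_X w a n v) (Suc j) =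
     complex_of_real (sqrt (w (Suc j)) / sqrt (wsum w n)) * Poly_Mapping.lookup v (Suc (Suc j)) +
     complex_of_real ((a (Suc j) - a n) / sqrt (wsum w n)) * Poly_Mapping.lookup v (Suc j) +
     complex_of_real (sqrt (w j) / sqrt (wsum w n)) * Poly_Mapping.lookup v j"
  by (simp add: normalized_X_def opX_def lookup_add lookup_minus lookup_opA lookup_opB
      lookup_opC_Suc diff_divide_distrib algebra_simps)

lemma finner_Phi_right: "finner v (Phi n) = Poly_Mapping.lookup v n"
proof -
  have "finner v (Phi n) = (\<Sum>m\<in>Poly_Mapping.keys v \<union> Poly_Mapping.keys (Phi n).
      if n = m then Poly_Mapping.lookup v m else 0)"
    unfolding finner_def by (rule sum.cong) (auto simp: lookup_Phi)
  then show ?thesis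
    by (auto simp: in_keys_iff lookup_Phi)
qed

lemma norm_lookup_le_fnorm: "norm (Poly_Mapping.lookup v j) \<le> fnorm v"
proof (cases "j \<in> Poly_Mapping.keys v")
  case True
  have "Re (finner v v) = (\<Sum>n\<in>Poly_Mapping.keys v. (norm (Poly_Mapping.lookup v n))\<^sup>2)"
    by (simp add: finner_def complex_mult_cnj cmod_power2)
  moreover have "(norm (Poly_Mapping.lookup v j))\<^sup>2 \<le>
      (\<Sum>n\<in>Poly_Mapping.keys v. (norm (Poly_Mapping.lookup v n))\<^sup>2)"
    using True by (intro member_le_sum) auto
  ultimately show ?thesis
    unfolding fnorm_def by (metis real_le_rsqrt)
next
  case False
  have "0 \<le> Re (finner v v)"
    by (auto simp: finner_def intro!: sum_nonneg)
  with False show ?thesis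
    by (simp add: in_keys_iff fnorm_def)
qed

text \<open>Every coordinate is bounded by the norm, so the index \<open>j n\<close> may move with
  \<open>n\<close>. This matters because the commutators applied to \<open>Phi n\<close> sit at site
  \<open>n\<close> or \<open>n - 1\<close>.\<close>

lemma lookup_tendsto_0_if_ftendsto:
  assumes "ftendsto v 0"
  shows "(\<lambda>n. Poly_Mapping.lookup (v n) (j n)) \<longlonglongrightarrow> 0"
proof (rule Lim_null_comparison)
  show "(\<lambda>n. fnorm (v n)) \<longlonglongrightarrow> 0"
    using assms by (simp add: ftendsto_def)
qed (simp add: norm_lookup_le_fnorm)

lemma tendsto_of_real_0_iff:
  "((\<lambda>x. complex_of_real (f x)) \<longlongrightarrow> 0) F \<longleftrightarrow> (f \<longlongrightarrow> 0) F"
  using tendsto_of_real_iff[where ?'a = complex, of f 0 F] by simp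

text \<open>Sites near \<open>n\<close> are written \<open>nat (int n + k)\<close> so that one
  integer \<open>k\<close> covers both directions; for fixed \<open>k\<close> the truncation in
  \<open>nat\<close> affects only finitely many \<open>n\<close>.\<close>

lemma filterlim_nat_int_add: "filterlim (\<lambda>n. nat (int n + k)) at_top at_top"
  unfolding filterlim_at_top
proof
  fix Z show "eventually (\<lambda>n. Z \<le> nat (int n + k)) at_top"
    by (rule eventually_sequentiallyI[of "Z + nat \<bar>k\<bar>"]) linarith
qed

lemma eventually_int_add_ge: "eventually (\<lambda>n. int n + k \<ge> c) at_top"
  by (rule eventually_sequentiallyI[of "nat (\<bar>k\<bar> + \<bar>c\<bar>)"]) linarith

section \<open>Asymptotics of the Jacobi sequence and of the matrix coefficients under
  (RAC1)\<close>

context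
  fixes w a :: "nat \<Rightarrow> real"
  assumes jac: "jacobi_sequence w a"
    and rac: "RAC1 w a"
begin

lemma w_pos: "w n > 0"
  using jac by (simp add: jacobi_sequence_def)

lemma wsum_pos: "wsum w n > 0"
  using w_pos by (simp add: wsum_def add_pos_pos)

lemma w_nonzero: "w n \<noteq> 0" and wsum_nonzero: "wsum w n \<noteq> 0"
  using w_pos[of n] wsum_pos[of n] by simp_all

text \<open>For \<open>n\<close> \<ge> 1, \<open>Phi n\<close> is an eigenvector of AC - CA with
  eigenvalue \<open>w n - w (n - 1)\<close>. Passing to \<open>Suc n\<close> skips
  \<open>n = 0\<close>, where \<open>n - 1\<close> is truncated.\<close>

lemma commutator_AC_tendsto:
  "(\<lambda>n. (w (Suc n) - w n) / wsum w (Suc n)) \<longlonglongrightarrow> 0"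
proof -
  have "(\<lambda>n. Poly_Mapping.lookup (fscale (complex_of_real (1 / wsum w n))
       (opA w (opC w (Phi n)) - opC w (opA w (Phi n)))) n) \<longlonglongrightarrow> 0"
    using rac unfolding RAC1_def by (intro lookup_tendsto_0_if_ftendsto) auto
  then have "(\<lambda>n. Poly_Mapping.lookup (fscale (complex_of_real (1 / wsum w (Suc n)))
       (opA w (opC w (Phi (Suc n))) - opC w (opA w (Phi (Suc n))))) (Suc n)) \<longlonglongrightarrow> 0"
    by (rule LIMSEQ_Suc)
  moreover have "Poly_Mapping.lookup (fscale (complex_of_real (1 / wsum w (Suc n)))
       (opA w (opC w (Phi (Suc n))) - opC w (opA w (Phi (Suc n))))) (Suc n) =
       complex_of_real ((w (Suc n) - w n) / wsum w (Suc n))" for n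
  proof -
    have "complex_of_real (sqrt (w i)) * complex_of_real (sqrt (w i)) = complex_of_real (w i)" for i
      using w_pos[of i] by (simp flip: of_real_mult)
    then show ?thesis
      by (simp add: lookup_minus lookup_opA lookup_opC_Suc lookup_Phi)
  qed
  ultimately show ?thesis
    by (simp only: tendsto_of_real_0_iff)
qed

text \<open>A lowers the index and B is diagonal, so AB - BA sends \<open>Phi (Suc n)\<close> to a
  multiple of \<open>Phi n\<close>; the moving index \<open>n - 1\<close> reads off that
  multiple.\<close>

lemma commutator_AB_tendsto:
  "(\<lambda>n. sqrt (w n) * (a (Suc n) - a n) / wsum w (Suc n)) \<longlonglongrightarrow> 0"
proof -
  have "(\<lambda>n. Poly_Mapping.lookup (fscale (complex_of_real (1 / wsum w n))
       (opA w (opB a (Phi n)) - opB a (opA w (Phi n)))) (n - 1)) \<longlonglongrightarrow> 0"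
    using rac unfolding RAC1_def by (intro lookup_tendsto_0_if_ftendsto) auto
  then have "(\<lambda>n. Poly_Mapping.lookup (fscale (complex_of_real (1 / wsum w (Suc n)))
       (opA w (opB a (Phi (Suc n))) - opB a (opA w (Phi (Suc n))))) (Suc n - 1)) \<longlonglongrightarrow> 0"
    by (rule LIMSEQ_Suc)
  moreover have "Poly_Mapping.lookup (fscale (complex_of_real (1 / wsum w (Suc n)))
       (opA w (opB a (Phi (Suc n))) - opB a (opA w (Phi (Suc n))))) (Suc n - 1) =
       complex_of_real (sqrt (w n) * (a (Suc n) - a n) / wsum w (Suc n))" for n
    by (simp add: lookup_minus lookup_opA lookup_opB lookup_Phi algebra_simps diff_divide_distrib)
  ultimately show ?thesis
    by (simp only: tendsto_of_real_0_iff)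
qed

text \<open>With r = (x - y) / (x + y), the shares x / (x + y) and y / (x + y) are (1 + r) / 2 and
  (1 - r) / 2, and r tends to 0 by the AC commutator limit.\<close>

lemma w_wsum_Suc_tendsto:
  shows "(\<lambda>n. w (Suc n) / wsum w (Suc n)) \<longlonglongrightarrow> 1 / 2"
    and "(\<lambda>n. w n / wsum w (Suc n)) \<longlonglongrightarrow> 1 / 2"
proof -
  let ?r = "\<lambda>n. (w (Suc n) - w n) / wsum w (Suc n)"
  have nz: "w (Suc n) + w n \<noteq> 0" for n
    using w_pos[of n] w_pos[of "Suc n"] by linarith
  have "(\<lambda>n. (1 + ?r n) / 2) \<longlonglongrightarrow> (1 + 0) / 2"
    by (intro tendsto_intros commutator_AC_tendsto) auto
  moreover have "(1 + ?r n) / 2 = w (Suc n) / wsum w (Suc n)" for n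
    using nz[of n] by (simp add: wsum_def field_simps)
  ultimately show "(\<lambda>n. w (Suc n) / wsum w (Suc n)) \<longlonglongrightarrow> 1 / 2"
    by simp
  have "(\<lambda>n. (1 - ?r n) / 2) \<longlonglongrightarrow> (1 - 0) / 2"
    by (intro tendsto_intros commutator_AC_tendsto) auto
  moreover have "(1 - ?r n) / 2 = w n / wsum w (Suc n)" for n
    using nz[of n] by (simp add: wsum_def field_simps)
  ultimately show "(\<lambda>n. w n / wsum w (Suc n)) \<longlonglongrightarrow> 1 / 2"
    by simp
qed

lemma w_ratio_tendsto: "(\<lambda>n. w (Suc n) / w n) \<longlonglongrightarrow> 1"
proof -
  have "(\<lambda>n. (w (Suc n) / wsum w (Suc n)) / (w n / wsum w (Suc n))) \<longlonglongrightarrow> (1 / 2) / (1 / 2)"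
    by (intro tendsto_divide w_wsum_Suc_tendsto) auto
  then show ?thesis by (simp add: wsum_nonzero)
qed

text \<open>Dividing by \<open>w n / wsum w (Suc n)\<close>, which tends to 1 / 2, trades the
  denominator for \<open>w n\<close>; one factor \<open>sqrt (w n)\<close> then cancels.\<close>

lemma a_diff_tendsto: "(\<lambda>n. (a (Suc n) - a n) / sqrt (w n)) \<longlonglongrightarrow> 0"
proof -
  have "(\<lambda>n. (sqrt (w n) * (a (Suc n) - a n) / wsum w (Suc n)) / (w n / wsum w (Suc n)))
      \<longlonglongrightarrow> 0 / (1 / 2)"
    by (intro tendsto_divide w_wsum_Suc_tendsto commutator_AB_tendsto) auto
  moreover have "(sqrt (w n) * (a (Suc n) - a n) / wsum w (Suc n)) / (w n / wsum w (Suc n)) =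
      (a (Suc n) - a n) / sqrt (w n)" for n
  proof -
    have "x * d / W / (x * x / W) = d / x" if "x \<noteq> 0" "W \<noteq> 0" for x d W :: real
      using that by simp
    from this[of "sqrt (w n)" "wsum w (Suc n)"] show ?thesis
      using w_pos[of n] wsum_nonzero by simp
  qed
  ultimately show ?thesis by simp
qed

text \<open>Moving one site multiplies or divides by a ratio of neighbouring weights, which tends to
  1, so the limit at \<open>k = 0\<close> persists in both directions.\<close>

lemma w_shift_tendsto: "(\<lambda>n. w (nat (int n + k)) / wsum w n) \<longlonglongrightarrow> 1 / 2"
proof (induction k rule: int_induct[where k = 0])
  case base
  show ?case
    by (rule LIMSEQ_imp_Suc) (simp only: add_0_right nat_int w_wsum_Suc_tendsto(1))
next
  case (step1 i)
  have lim: "(\<lambda>n. w (Suc (nat (int n + i))) / w (nat (int n + i))) \<longlonglongrightarrow> 1"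
    by (rule filterlim_compose[OF w_ratio_tendsto filterlim_nat_int_add])
  from tendsto_mult[OF lim step1.IH] have
    "(\<lambda>n. w (Suc (nat (int n + i))) / w (nat (int n + i)) *
      (w (nat (int n + i)) / wsum w n)) \<longlonglongrightarrow> 1 / 2"
    by (simp only: mult_1)
  then show ?case
  proof (rule Lim_transform_eventually)
    show "\<forall>\<^sub>F n in sequentially. w (Suc (nat (int n + i))) / w (nat (int n + i)) *
        (w (nat (int n + i)) / wsum w n) = w (nat (int n + (i + 1))) / wsum w n"
      using eventually_int_add_ge[of 0 i]
    proof eventually_elim
      case (elim n)
      then have "nat (int n + (i + 1)) = Suc (nat (int n + i))" by linarith
      then show ?case using w_pos[of "nat (int n + i)"] by simp
    qed
  qed
next
  case (step2 i)
  have "(\<lambda>n. w (Suc (nat (int n + (i - 1)))) / w (nat (int n + (i - 1)))) \<longlonglongrightarrow> 1"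
    by (rule filterlim_compose[OF w_ratio_tendsto filterlim_nat_int_add])
  from tendsto_divide[OF step2.IH this] have
    "(\<lambda>n. w (nat (int n + i)) / wsum w n /
      (w (Suc (nat (int n + (i - 1)))) / w (nat (int n + (i - 1))))) \<longlonglongrightarrow> 1 / 2"
    by simp
  then show ?case
  proof (rule Lim_transform_eventually)
    show "\<forall>\<^sub>F n in sequentially. w (nat (int n + i)) / wsum w n /
        (w (Suc (nat (int n + (i - 1)))) / w (nat (int n + (i - 1)))) =
        w (nat (int n + (i - 1))) / wsum w n"
      using eventually_int_add_ge[of 1 i]
    proof eventually_elim
      case (elim n)
      then have "nat (int n + i) = Suc (nat (int n + (i - 1)))" by linarith
      then show ?case using w_pos[of "Suc (nat (int n + (i - 1)))"] by simp
    qed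
  qed
qed

lemma sqrt_w_shift_tendsto:
  "(\<lambda>n. sqrt (w (nat (int n + k))) / sqrt (wsum w n)) \<longlonglongrightarrow> 1 / sqrt 2"
  using tendsto_real_sqrt[OF w_shift_tendsto[of k]] by (simp only: real_sqrt_divide real_sqrt_one)

lemma a_increment_tendsto:
  "(\<lambda>n. (a (Suc (nat (int n + k))) - a (nat (int n + k))) / sqrt (wsum w n)) \<longlonglongrightarrow> 0"
proof -
  have "(\<lambda>n. (a (Suc (nat (int n + k))) - a (nat (int n + k))) / sqrt (w (nat (int n + k)))) \<longlonglongrightarrow> 0"
    by (rule filterlim_compose[OF a_diff_tendsto filterlim_nat_int_add])
  from tendsto_mult[OF this sqrt_w_shift_tendsto[of k]] show ?thesis
    by (simp add: w_nonzero)
qed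

text \<open>The difference telescopes into |k| neighbouring increments, each negligible against
  \<open>sqrt (wsum w n)\<close>; for negative \<open>k\<close> they are subtracted.\<close>

lemma a_shift_tendsto: "(\<lambda>n. (a (nat (int n + k)) - a n) / sqrt (wsum w n)) \<longlonglongrightarrow> 0"
proof (induction k rule: int_induct[where k = 0])
  case base
  show ?case by simp
next
  case (step1 i)
  from tendsto_add[OF a_increment_tendsto[of i] step1.IH] have
    "(\<lambda>n. (a (Suc (nat (int n + i))) - a (nat (int n + i))) / sqrt (wsum w n) +
        (a (nat (int n + i)) - a n) / sqrt (wsum w n)) \<longlonglongrightarrow> 0"
    by (simp only: add_0)
  then show ?case
  proof (rule Lim_transform_eventually)
    show "\<forall>\<^sub>F n in sequentially.
        (a (Suc (nat (int n + i))) - a (nat (int n + i))) / sqrt (wsum w n) +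
        (a (nat (int n + i)) - a n) / sqrt (wsum w n) =
        (a (nat (int n + (i + 1))) - a n) / sqrt (wsum w n)"
      using eventually_int_add_ge[of 0 i]
    proof eventually_elim
      case (elim n)
      then have "nat (int n + (i + 1)) = Suc (nat (int n + i))" by linarith
      then show ?case by (simp add: diff_divide_distrib)
    qed
  qed
next
  case (step2 i)
  from tendsto_diff[OF step2.IH a_increment_tendsto[of "i - 1"]] have
    "(\<lambda>n. (a (nat (int n + i)) - a n) / sqrt (wsum w n) -
        (a (Suc (nat (int n + (i - 1)))) - a (nat (int n + (i - 1)))) / sqrt (wsum w n)) \<longlonglongrightarrow> 0"
    by (simp only: diff_0_right)
  then show ?case
  proof (rule Lim_transform_eventually)
    show "\<forall>\<^sub>F n in sequentially. (a (nat (int n + i)) - a n) / sqrt (wsum w n) -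
        (a (Suc (nat (int n + (i - 1)))) - a (nat (int n + (i - 1)))) / sqrt (wsum w n) =
        (a (nat (int n + (i - 1))) - a n) / sqrt (wsum w n)"
      using eventually_int_add_ge[of 1 i]
    proof eventually_elim
      case (elim n)
      then have "nat (int n + i) = Suc (nat (int n + (i - 1)))" by linarith
      then show ?case by (simp add: diff_divide_distrib)
    qed
  qed
qed

text \<open>Induction on \<open>m\<close> for all \<open>k\<close> at once, since the value at
  \<open>k\<close> uses those at \<open>k + 1\<close> and \<open>k - 1\<close>. The diagonal entry
  tends to 0 and both off-diagonal entries to 1 / sqrt 2. \<open>L\<close> enters only through its
  recursion, so a closed form can be inserted later.\<close>

lemma lookup_power_normalized_X_tendsto:
  fixes L :: "nat \<Rightarrow> int \<Rightarrow> real"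
  assumes L0: "\<And>k. L 0 k = (if k = 0 then 1 else 0)"
    and L_Suc: "\<And>m k. L (Suc m) k = (L m (k + 1) + L m (k - 1)) / sqrt 2"
  shows "(\<lambda>n. Poly_Mapping.lookup ((normalized_X w a n ^^ m) (Phi n)) (nat (int n + k)))
    \<longlonglongrightarrow> complex_of_real (L m k)"
proof (induction m arbitrary: k)
  case 0
  show ?case
  proof (rule tendsto_eventually)
    show "\<forall>\<^sub>F n in sequentially. Poly_Mapping.lookup ((normalized_X w a n ^^ 0) (Phi n))
        (nat (int n + k)) = complex_of_real (L 0 k)"
      using eventually_int_add_ge[of 0 k]
    proof eventually_elim
      case (elim n)
      then have "n = nat (int n + k) \<longleftrightarrow> k = 0" by linarith
      then show ?case by (simp add: L0 lookup_Phi)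
    qed
  qed
next
  case (Suc m)
  let ?v = "\<lambda>n. (normalized_X w a n ^^ m) (Phi n)"
  have "(\<lambda>n. complex_of_real (sqrt (w (nat (int n + k))) / sqrt (wsum w n)) *
        Poly_Mapping.lookup (?v n) (nat (int n + (k + 1))) +
      complex_of_real ((a (nat (int n + k)) - a n) / sqrt (wsum w n)) *
        Poly_Mapping.lookup (?v n) (nat (int n + k)) +
      complex_of_real (sqrt (w (nat (int n + (k - 1)))) / sqrt (wsum w n)) *
        Poly_Mapping.lookup (?v n) (nat (int n + (k - 1))))
    \<longlonglongrightarrow> complex_of_real (1 / sqrt 2) * complex_of_real (L m (k + 1)) +
      complex_of_real 0 * complex_of_real (L m k) +
      complex_of_real (1 / sqrt 2) * complex_of_real (L m (k - 1))"
    by (intro tendsto_add tendsto_mult tendsto_of_real Suc.IH sqrt_w_shift_tendsto a_shift_tendsto)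
  also have "complex_of_real (1 / sqrt 2) * complex_of_real (L m (k + 1)) +
      complex_of_real 0 * complex_of_real (L m k) +
      complex_of_real (1 / sqrt 2) * complex_of_real (L m (k - 1)) = complex_of_real (L (Suc m) k)"
    by (simp add: L_Suc add_divide_distrib)
  finally show ?case
  proof (rule Lim_transform_eventually)
    show "\<forall>\<^sub>F n in sequentially.
        complex_of_real (sqrt (w (nat (int n + k))) / sqrt (wsum w n)) *
          Poly_Mapping.lookup (?v n) (nat (int n + (k + 1))) +
        complex_of_real ((a (nat (int n + k)) - a n) / sqrt (wsum w n)) *
          Poly_Mapping.lookup (?v n) (nat (int n + k)) +
        complex_of_real (sqrt (w (nat (int n + (k - 1)))) / sqrt (wsum w n)) *
          Poly_Mapping.lookup (?v n) (nat (int n + (k - 1))) =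
        Poly_Mapping.lookup ((normalized_X w a n ^^ Suc m) (Phi n)) (nat (int n + k))"
      \<comment> \<open>The bound 1 makes \<open>int n + (k - 1)\<close> nonnegative: none of the
        three sites is truncated, and the row in question is a successor row.\<close>
      using eventually_int_add_ge[of 1 k]
    proof eventually_elim
      case (elim n)
      then have "nat (int n + k) = Suc (nat (int n + (k - 1)))"
        "nat (int n + (k + 1)) = Suc (Suc (nat (int n + (k - 1))))" by linarith+
      then show ?case by (simp only: funpow.simps comp_apply lookup_normalized_X_Suc)
    qed
  qed
qed

end

section \<open>The substitution x = sqrt 2 * sin t in the arcsine integrals\<close>

lemma arcsine_density_substitution:
  assumes "- (pi / 2) < t" "t < pi / 2"
  shows "1 / (pi * sqrt (2 - (sqrt 2 * sin t)\<^sup>2)) * (sqrt 2 * cos t) = 1 / pi"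
    and "2 - (sqrt 2 * sin t)\<^sup>2 > 0"
proof -
  have "cos t > 0" using assms by (intro cos_gt_zero_pi) auto
  \<comment> \<open>Since \<open>cos t > 0\<close>, the square root of this is
    \<open>sqrt 2 * cos t\<close>, which the Jacobian cancels: in the variable \<open>t\<close> the
    arcsine density is uniform.\<close>
  have eq: "2 - (sqrt 2 * sin t)\<^sup>2 = 2 * (cos t)\<^sup>2"
    by (simp add: power_mult_distrib cos_squared_eq)
  show "2 - (sqrt 2 * sin t)\<^sup>2 > 0"
    unfolding eq using \<open>cos t > 0\<close> by simp
  show "1 / (pi * sqrt (2 - (sqrt 2 * sin t)\<^sup>2)) * (sqrt 2 * cos t) = 1 / pi"
    unfolding eq using \<open>cos t > 0\<close> by (simp add: real_sqrt_mult)
qed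

text \<open>The density is singular at both ends, so the substitution runs over open intervals and
  its endpoints enter as one-sided limits, in the \<open>ereal\<close> form of the substitution
  rules.\<close>

lemma filterlim_sqrt2_sin:
  "((ereal \<circ> (\<lambda>t. sqrt 2 * sin t) \<circ> real_of_ereal) \<longlongrightarrow> ereal (- sqrt 2)) (at_right (ereal (- (pi / 2))))"
  "((ereal \<circ> (\<lambda>t. sqrt 2 * sin t) \<circ> real_of_ereal) \<longlongrightarrow> ereal (sqrt 2)) (at_left (ereal (pi / 2)))"
proof -
  have "((\<lambda>t. sqrt 2 * sin t) \<longlongrightarrow> sqrt 2 * sin (- (pi / 2))) (at_right (- (pi / 2)))"
    by (intro tendsto_intros)
  then show "((ereal \<circ> (\<lambda>t. sqrt 2 * sin t) \<circ> real_of_ereal) \<longlongrightarrow> ereal (- sqrt 2)) (at_right (ereal (- (pi / 2))))"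
    by (simp add: ereal_tendsto_simps del: uminus_ereal.simps)
  have "((\<lambda>t. sqrt 2 * sin t) \<longlongrightarrow> sqrt 2 * sin (pi / 2)) (at_left (pi / 2))"
    by (intro tendsto_intros)
  then show "((ereal \<circ> (\<lambda>t. sqrt 2 * sin t) \<circ> real_of_ereal) \<longlongrightarrow> ereal (sqrt 2)) (at_left (ereal (pi / 2)))"
    by (simp add: ereal_tendsto_simps)
qed

lemma set_integrable_einterval_isCont:
  fixes f :: "real \<Rightarrow> real"
  assumes "\<And>x. isCont f x"
  shows "set_integrable lborel (einterval (ereal a) (ereal b)) f"
proof -
  have "set_integrable lborel {a..b} f"
    using assms by (intro borel_integrable_atLeastAtMost') (simp add: continuous_at_imp_continuous_on)
  then show ?thesis
    by (rule set_integrable_subset) (auto simp: einterval_def)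
qed

text \<open>The density is unbounded, so its integrability is pulled back through the substitution
  rule for nonnegative integrands to that of the constant 1 / pi.\<close>

lemma set_integrable_arcsine_density:
  "set_integrable lborel {- sqrt 2<..<sqrt 2} (\<lambda>x. 1 / (pi * sqrt (2 - x\<^sup>2)))"
proof -
  have "set_integrable lborel (einterval (ereal (- sqrt 2)) (ereal (sqrt 2)))
      (\<lambda>x. 1 / (pi * sqrt (2 - x\<^sup>2)))"
  proof (rule interval_integral_substitution_nonneg(1)[where
        g = "\<lambda>t. sqrt 2 * sin t" and g' = "\<lambda>t. sqrt 2 * cos t", OF _ _ _ _ _ _ filterlim_sqrt2_sin])
    show "ereal (- (pi / 2)) < ereal (pi / 2)" by simp
    show "((\<lambda>t. sqrt 2 * sin t) has_real_derivative sqrt 2 * cos x) (at x)" for x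
      by (auto intro!: derivative_eq_intros)
    show "isCont (\<lambda>x. 1 / (pi * sqrt (2 - x\<^sup>2))) (sqrt 2 * sin x)"
      if "ereal (- (pi / 2)) < ereal x" "ereal x < ereal (pi / 2)" for x
      using arcsine_density_substitution(2)[of x] that by (intro continuous_intros) auto
    show "isCont (\<lambda>t. sqrt 2 * cos t) x" for x
      by (intro continuous_intros)
    show "0 \<le> 1 / (pi * sqrt (2 - (sqrt 2 * sin x)\<^sup>2))"
      if "ereal (- (pi / 2)) < ereal x" "ereal x < ereal (pi / 2)" for x
      using arcsine_density_substitution(2)[of x] that by simp
    show "0 \<le> sqrt 2 * cos x"
      if "ereal (- (pi / 2)) \<le> ereal x" "ereal x \<le> ereal (pi / 2)" for x
      using that by (simp add: cos_ge_zero)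
    have "set_integrable lborel (einterval (ereal (- (pi / 2))) (ereal (pi / 2))) (\<lambda>x. 1 / pi)"
      by (rule set_integrable_einterval_isCont) simp
    also have "?this \<longleftrightarrow> set_integrable lborel (einterval (ereal (- (pi / 2))) (ereal (pi / 2)))
        (\<lambda>x. 1 / (pi * sqrt (2 - (sqrt 2 * sin x)\<^sup>2)) * (sqrt 2 * cos x))"
      by (intro set_integrable_cong arcsine_density_substitution(1)[symmetric] refl)
        (auto simp: einterval_def)
    finally show "set_integrable lborel (einterval (ereal (- (pi / 2))) (ereal (pi / 2)))
        (\<lambda>x. 1 / (pi * sqrt (2 - (sqrt 2 * sin x)\<^sup>2)) * (sqrt 2 * cos x))" .
  qed
  then show ?thesis by simp
qed

lemma set_integrable_arcsine_moment:
  "set_integrable lborel {- sqrt 2<..<sqrt 2} (\<lambda>x. x ^ m * (1 / (pi * sqrt (2 - x\<^sup>2))))"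
proof (rule set_integrable_bound)
  show "set_integrable lborel {- sqrt 2<..<sqrt 2} (\<lambda>x. sqrt 2 ^ m * (1 / (pi * sqrt (2 - x\<^sup>2))))"
    using set_integrable_arcsine_density by (intro set_integrable_mult_right) auto
  show "set_borel_measurable lborel {- sqrt 2<..<sqrt 2} (\<lambda>x. x ^ m * (1 / (pi * sqrt (2 - x\<^sup>2))))"
    unfolding set_borel_measurable_def by simp
  have "norm (x ^ m * (1 / (pi * sqrt (2 - x\<^sup>2)))) \<le> norm (sqrt 2 ^ m * (1 / (pi * sqrt (2 - x\<^sup>2))))"
    if "x \<in> {- sqrt 2<..<sqrt 2}" for x
    unfolding norm_mult norm_power using that by (intro mult_right_mono power_mono) auto
  then show "AE x in lborel. x \<in> {- sqrt 2<..<sqrt 2} \<longrightarrow>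
      norm (x ^ m * (1 / (pi * sqrt (2 - x\<^sup>2)))) \<le> norm (sqrt 2 ^ m * (1 / (pi * sqrt (2 - x\<^sup>2))))"
    by (intro AE_I2 impI)
qed

text \<open>For odd \<open>m\<close> the integrand changes sign, so the rule for integrable
  functions is used; its integrability premise comes from bounding |x| by sqrt 2.\<close>

lemma arcsine_moment_substitution:
  "(LBINT x:{- sqrt 2<..<sqrt 2}. x ^ m * (1 / (pi * sqrt (2 - x\<^sup>2)))) =
   (LBINT t=- (pi / 2)..pi / 2. (sqrt 2 * sin t) ^ m / pi)"
proof -
  have eq: "(sqrt 2 * cos t) *\<^sub>R ((sqrt 2 * sin t) ^ m * (1 / (pi * sqrt (2 - (sqrt 2 * sin t)\<^sup>2)))) =
      (sqrt 2 * sin t) ^ m / pi"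
    if "t \<in> einterval (ereal (- (pi / 2))) (ereal (pi / 2))" for t
  proof -
    have "(sqrt 2 * sin t) ^ m * (1 / (pi * sqrt (2 - (sqrt 2 * sin t)\<^sup>2)) * (sqrt 2 * cos t)) =
        (sqrt 2 * sin t) ^ m * (1 / pi)"
      using arcsine_density_substitution(1)[of t] that by (simp only: einterval_def) simp
    then show ?thesis by (simp add: ac_simps)
  qed
  have "(LBINT x=ereal (- sqrt 2)..ereal (sqrt 2). x ^ m * (1 / (pi * sqrt (2 - x\<^sup>2)))) =
    (LBINT t=ereal (- (pi / 2))..ereal (pi / 2). (sqrt 2 * cos t) *\<^sub>R
      ((sqrt 2 * sin t) ^ m * (1 / (pi * sqrt (2 - (sqrt 2 * sin t)\<^sup>2)))))"
  proof (rule interval_integral_substitution_integrable[where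
        g = "\<lambda>t. sqrt 2 * sin t" and g' = "\<lambda>t. sqrt 2 * cos t", OF _ _ _ _ _ filterlim_sqrt2_sin])
    show "ereal (- (pi / 2)) < ereal (pi / 2)" by simp
    show "((\<lambda>t. sqrt 2 * sin t) has_real_derivative sqrt 2 * cos x) (at x)" for x
      by (auto intro!: derivative_eq_intros)
    show "isCont (\<lambda>x. x ^ m * (1 / (pi * sqrt (2 - x\<^sup>2)))) (sqrt 2 * sin x)"
      if "ereal (- (pi / 2)) < ereal x" "ereal x < ereal (pi / 2)" for x
      using arcsine_density_substitution(2)[of x] that by (intro continuous_intros) auto
    show "isCont (\<lambda>t. sqrt 2 * cos t) x" for x
      by (intro continuous_intros)
    show "0 \<le> sqrt 2 * cos x"
      if "ereal (- (pi / 2)) \<le> ereal x" "ereal x \<le> ereal (pi / 2)" for x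
      using that by (simp add: cos_ge_zero)
    have "set_integrable lborel (einterval (ereal (- (pi / 2))) (ereal (pi / 2)))
        (\<lambda>t. (sqrt 2 * sin t) ^ m / pi)"
      by (rule set_integrable_einterval_isCont) (intro continuous_intros, simp)
    also have "?this \<longleftrightarrow> set_integrable lborel (einterval (ereal (- (pi / 2))) (ereal (pi / 2)))
        (\<lambda>t. (sqrt 2 * cos t) *\<^sub>R
          ((sqrt 2 * sin t) ^ m * (1 / (pi * sqrt (2 - (sqrt 2 * sin t)\<^sup>2)))))"
      by (intro set_integrable_cong eq[symmetric] refl)
    finally show "set_integrable lborel (einterval (ereal (- (pi / 2))) (ereal (pi / 2)))
        (\<lambda>t. (sqrt 2 * cos t) *\<^sub>R
          ((sqrt 2 * sin t) ^ m * (1 / (pi * sqrt (2 - (sqrt 2 * sin t)\<^sup>2)))))" .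
    show "set_integrable lborel (einterval (ereal (- sqrt 2)) (ereal (sqrt 2)))
        (\<lambda>x. x ^ m * (1 / (pi * sqrt (2 - x\<^sup>2))))"
      using set_integrable_arcsine_moment by simp
  qed
  also have "\<dots> = (LBINT t=ereal (- (pi / 2))..ereal (pi / 2). (sqrt 2 * sin t) ^ m / pi)"
    by (intro interval_integral_cong eq) auto
  finally show ?thesis
    by (simp add: interval_integral_Ioo)
qed

section \<open>Fourier coefficients of the limit and their recursion\<close>

text \<open>With \<open>t = pi / 2 - u\<close>, so that the substitution \<open>x = sqrt 2 * sin t\<close> is increasing.\<close>
definition arcsine_coeff :: "nat \<Rightarrow> int \<Rightarrow> real" where
  "arcsine_coeff m k =
     (LBINT t=- (pi / 2)..pi / 2. (sqrt 2 * sin t) ^ m / pi * cos (real_of_int k * (pi / 2 - t)))"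

text \<open>Orthogonality of the cosines: for nonzero \<open>k\<close>, cos (k * u) integrates to 0
  over 0 \<le> u \<le> pi, as the antiderivative takes the end values sin 0 and sin (k * pi) up to a
  factor.\<close>

lemma arcsine_coeff_0: "arcsine_coeff 0 k = (if k = 0 then 1 else 0)"
proof (cases "k = 0")
  case True
  then show ?thesis by (simp add: arcsine_coeff_def)
next
  case False
  have "arcsine_coeff 0 k = (LBINT t=ereal (- (pi / 2))..ereal (pi / 2). cos (real_of_int k * (pi / 2 - t)) / pi)"
    by (simp add: arcsine_coeff_def)
  also have "\<dots> = - sin (real_of_int k * (pi / 2 - pi / 2)) / (real_of_int k * pi) -
      - sin (real_of_int k * (pi / 2 - - (pi / 2))) / (real_of_int k * pi)"
  proof (rule interval_integral_FTC_finite)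
    show "continuous_on {min (- (pi / 2)) (pi / 2)..max (- (pi / 2)) (pi / 2)}
        (\<lambda>t. cos (real_of_int k * (pi / 2 - t)) / pi)"
      by (intro continuous_intros) auto
    show "((\<lambda>t. - sin (real_of_int k * (pi / 2 - t)) / (real_of_int k * pi)) has_vector_derivative
        cos (real_of_int k * (pi / 2 - x)) / pi)
        (at x within {min (- (pi / 2)) (pi / 2)..max (- (pi / 2)) (pi / 2)})" for x
      unfolding has_real_derivative_iff_has_vector_derivative[symmetric] using False
      by (auto intro!: derivative_eq_intros)
  qed
  also have "\<dots> = 0"
    using sin_zero_iff_int2[of "real_of_int k * pi"] by auto
  finally show ?thesis using False by simp
qed

text \<open>Multiplication by \<open>sqrt 2 * cos u\<close> acts on the Fourier modes as the
  normalized sum of the two shifts, because 2 cos u cos (k u) = cos ((k + 1) u) + cos ((k - 1)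
  u).\<close>

lemma arcsine_coeff_Suc:
  "arcsine_coeff (Suc m) k = (arcsine_coeff m (k + 1) + arcsine_coeff m (k - 1)) / sqrt 2"
proof -
  have int: "interval_lebesgue_integrable lborel (ereal (- (pi / 2))) (ereal (pi / 2))
      (\<lambda>t. (sqrt 2 * sin t) ^ m / pi * cos (real_of_int k * (pi / 2 - t)))" for k
    by (intro interval_integrable_isCont continuous_intros) auto
  have step: "(sqrt 2 * sin t) ^ Suc m / pi * cos (real_of_int k * (pi / 2 - t)) =
      ((sqrt 2 * sin t) ^ m / pi * cos (real_of_int (k + 1) * (pi / 2 - t)) +
       (sqrt 2 * sin t) ^ m / pi * cos (real_of_int (k - 1) * (pi / 2 - t))) / sqrt 2" for t
  proof -
    define u where "u = pi / 2 - t"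
    have "sin t = cos u" by (simp add: u_def cos_diff)
    moreover have "cos (real_of_int (k + 1) * u) + cos (real_of_int (k - 1) * u) =
        2 * cos u * cos (real_of_int k * u)"
      by (simp add: algebra_simps cos_add cos_diff)
    moreover have "2 / sqrt 2 = sqrt 2"
      by (simp add: real_div_sqrt)
    ultimately have "sqrt 2 * sin t * cos (real_of_int k * u) =
        (cos (real_of_int (k + 1) * u) + cos (real_of_int (k - 1) * u)) / sqrt 2"
      by (simp add: field_simps)
    then have "(sqrt 2 * sin t) ^ m / pi * (sqrt 2 * sin t * cos (real_of_int k * u)) =
        (sqrt 2 * sin t) ^ m / pi *
        ((cos (real_of_int (k + 1) * u) + cos (real_of_int (k - 1) * u)) / sqrt 2)"
      by (rule arg_cong)
    then show ?thesis
      unfolding u_def[symmetric] by (simp add: field_simps)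
  qed
  show ?thesis
    unfolding arcsine_coeff_def step interval_lebesgue_integral_divide
      interval_lebesgue_integral_add(2)[OF int int] by (rule refl)
qed

lemma arcsine_coeff_eq_moment:
  "arcsine_coeff m 0 = (LBINT x:{- sqrt 2<..<sqrt 2}. x ^ m * (1 / (pi * sqrt (2 - x\<^sup>2))))"
  unfolding arcsine_coeff_def arcsine_moment_substitution by simp

section \<open>The arcsine law as a probability measure\<close>

lemma arcsine_weight_nonneg:
  "0 \<le> indicator {- sqrt 2<..<sqrt 2} x * (1 / (pi * sqrt (2 - x\<^sup>2)))" for x :: real
proof (cases "x \<in> {- sqrt 2<..<sqrt 2}")
  case True
  \<comment> \<open>Inside the interval the radicand is nonnegative. Outside, \<open>sqrt\<close> of
    a negative number is negative, and only the indicator removes that value.\<close>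
  then have "\<bar>x\<bar> \<le> \<bar>sqrt 2\<bar>" by auto
  then have "x\<^sup>2 \<le> 2"
    unfolding abs_le_square_iff by simp
  then show ?thesis by simp
qed simp

lemma
  shows moment_arcsine_law: "moment arcsine_law m =
      (LBINT x:{- sqrt 2<..<sqrt 2}. x ^ m * (1 / (pi * sqrt (2 - x\<^sup>2))))"
    and integrable_arcsine_law: "integrable arcsine_law (\<lambda>x. x ^ m)"
proof -
  have eq: "(indicator {- sqrt 2<..<sqrt 2} x * (1 / (pi * sqrt (2 - x\<^sup>2)))) *\<^sub>R x ^ m =
      indicator {- sqrt 2<..<sqrt 2} x *\<^sub>R (x ^ m * (1 / (pi * sqrt (2 - x\<^sup>2))))" for x :: real
    by simp
  show "moment arcsine_law m =
      (LBINT x:{- sqrt 2<..<sqrt 2}. x ^ m * (1 / (pi * sqrt (2 - x\<^sup>2))))"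
    unfolding moment_def arcsine_law_def set_lebesgue_integral_def eq[symmetric]
    by (rule integral_density) (simp_all only: arcsine_weight_nonneg AE_I2, measurable)
  show "integrable arcsine_law (\<lambda>x. x ^ m)"
    unfolding arcsine_law_def
    using set_integrable_arcsine_moment[of m, unfolded set_integrable_def, folded eq]
    by (subst integrable_density) (simp_all only: arcsine_weight_nonneg AE_I2, measurable)
qed

lemma real_distribution_arcsine_law: "real_distribution arcsine_law"
proof -
  have int: "integrable lborel (\<lambda>x. indicator {- sqrt 2<..<sqrt 2} x * (1 / (pi * sqrt (2 - x\<^sup>2))))"
    using set_integrable_arcsine_density by (simp add: set_integrable_def)
  \<comment> \<open>The total mass is the coefficient with \<open>m = 0\<close> and
    \<open>k = 0\<close>, already known to be 1.\<close>
  have "(\<integral>x. indicator {- sqrt 2<..<sqrt 2} x * (1 / (pi * sqrt (2 - x\<^sup>2))) \<partial>lborel) = 1"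
    using arcsine_coeff_eq_moment[of 0] by (simp add: arcsine_coeff_0 set_lebesgue_integral_def)
  then have "(\<integral>\<^sup>+x. ennreal (indicator {- sqrt 2<..<sqrt 2} x * (1 / (pi * sqrt (2 - x\<^sup>2)))) \<partial>lborel) = 1"
    using nn_integral_eq_integral[OF int] arcsine_weight_nonneg by simp
  then have "prob_space arcsine_law"
    unfolding arcsine_law_def
    by (intro prob_spaceI) (simp add: emeasure_density cong: nn_integral_cong)
  then show ?thesis
    by (simp add: real_distribution_def real_distribution_axioms_def arcsine_law_def)
qed

section \<open>Convergence of the moments\<close>

theorem theorem5p3:
  fixes w a :: "nat \<Rightarrow> real"
  assumes "jacobi_sequence w a"
    and "RAC1 w a"
  shows "classical_limit_distribution w a arcsine_law \<and>
    (\<forall>m::nat. (\<lambda>n. fock_moment w a n m) \<longlonglongrightarrow>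
       complex_of_real (LBINT x:{- sqrt 2<..<sqrt 2}. x ^ m * (1 / (pi * sqrt (2 - x\<^sup>2)))))"
proof -
  \<comment> \<open>The inner product with \<open>Phi n\<close> picks the coefficient at shift
    \<open>k = 0\<close>, and \<open>arcsine_coeff\<close> serves as the abstract
    \<open>L\<close>.\<close>
  have lim: "(\<lambda>n. fock_moment w a n m) \<longlonglongrightarrow> complex_of_real (moment arcsine_law m)" for m
    using lookup_power_normalized_X_tendsto[OF assms arcsine_coeff_0 arcsine_coeff_Suc, of m 0]
    by (simp add: fock_moment_def finner_Phi_right moment_arcsine_law arcsine_coeff_eq_moment)
  have "converges_in_moments N arcsine_law" if N: "represents_moments w a N" for N
    unfolding converges_in_moments_def
  proof
    fix m
    \<comment> \<open>The measure \<open>N 0\<close> is unconstrained, so equality is available only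
      from \<open>n = 1\<close> on.\<close>
    have "\<forall>\<^sub>F n in sequentially. fock_moment w a n m = complex_of_real (moment (N n) m)"
      using N by (intro eventually_sequentiallyI[of 1]) (simp add: represents_moments_def)
    from Lim_transform_eventually[OF lim this]
    show "(\<lambda>n. moment (N n) m) \<longlonglongrightarrow> moment arcsine_law m"
      by (simp only: tendsto_of_real_iff)
  qed
  then have "classical_limit_distribution w a arcsine_law"
    by (simp add: classical_limit_distribution_def finite_moments_def
        real_distribution_arcsine_law integrable_arcsine_law)
  with lim show ?thesis
    by (simp add: moment_arcsine_law)
qed

end
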